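(* Let $c>0$. Let $\widehat{C}_n$ be the monic orthogonal polynomials with respect to the weight $$\rho(x)=\frac{c^x}{x!},\qquad x\in\mathbb{N}_0$$ (monic Charlier polynomials). For $\beta>0$ let $P_{n,\beta}^{(0,1)}$ be the monic orthogonal polynomials with respect to $$\rho_\beta(x)=\frac{1}{(\beta+1)_x}\frac{(c\beta)^x}{x!},\qquad x\in\mathbb{N}_0$$ (generalized Charlier polynomials with parameters $\beta$ and $c\beta$). Then for every $n\in\mathbb{N}_0$ and every $x$, $$\lim_{\beta\to\infty}P_{n,\beta}^{(0,1)}(x)=\widehat{C}_n(x).$$
   Context: $(a)_x=a(a+1)\cdots(a+x-1)$, $(a)_0=1$, is the Pochhammer symbol, and $\mathbb{N}_0$ is the set of nonnegative integers. Given a positive weight $\rho$ with finite moments on $\mathbb{N}_0$, the monic orthogonal polynomials $P_n$ with respect to $\rho$ are the monic polynomials of degree $n$ satisfying $\sum_{x=0}^\infty P_n(x)x^k\rho(x)=0$ for $0\le k<n$. *)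

theory Defs
  imports Complex_Main "HOL-Computational_Algebra.Polynomial"
begin

(* The clause "sums 0" asserts convergence of the series as well as its value;
   for a weight with finite moments convergence is automatic. *)
definition is_monic_OP :: "(nat \<Rightarrow> real) \<Rightarrow> nat \<Rightarrow> real poly \<Rightarrow> bool" where
  "is_monic_OP \<rho> n p \<longleftrightarrow>
     degree p = n \<and> lead_coeff p = 1 \<and>
     (\<forall>k<n. (\<lambda>x. poly p (real x) * real x ^ k * \<rho> x) sums 0)"

(* Well defined when the weight is positive with finite moments: such a polynomial
   then exists and is unique, since the weight has infinite support. *)
definition monic_OP :: "(nat \<Rightarrow> real) \<Rightarrow> nat \<Rightarrow> real poly" where
  "monic_OP \<rho> n = (THE p. is_monic_OP \<rho> n p)"

definition charlier_weight :: "real \<Rightarrow> nat \<Rightarrow> real" where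
  "charlier_weight c x = c ^ x / fact x"

definition gen_charlier_weight :: "real \<Rightarrow> real \<Rightarrow> nat \<Rightarrow> real" where
  "gen_charlier_weight \<beta> z x = 1 / pochhammer (\<beta> + 1) x * (z ^ x / fact x)"

definition monic_charlier :: "real \<Rightarrow> nat \<Rightarrow> real poly" where
  "monic_charlier c = monic_OP (charlier_weight c)"

definition monic_gen_charlier :: "real \<Rightarrow> real \<Rightarrow> nat \<Rightarrow> real poly" where
  "monic_gen_charlier \<beta> z = monic_OP (gen_charlier_weight \<beta> z)"

end

(* The monic orthogonal polynomials are produced by Gram-Schmidt from the monomials, so their
   coefficients are continuous functions of the moments of the weight.  Since
   (c b)^x / (b+1)_x tends to c^x and is dominated by it, Tannery's theorem gives convergence of
   all moments of the generalized Charlier weight to those of the Charlier weight. *)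
theory Submission
  imports Defs "HOL-Analysis.Uniform_Limit" "HOL-Real_Asymp.Real_Asymp"
begin

section \<open>Orthogonal polynomials by Gram-Schmidt\<close>

definition weight_integral :: "(nat \<Rightarrow> real) \<Rightarrow> real poly \<Rightarrow> real" where
  "weight_integral w p = (\<Sum>x. poly p (real x) * w x)"

text \<open>\<open>suminf\<close> and division always return a value, so the recursion is total in
  \<open>w\<close>, and degree and leading coefficient can be computed before anything is known
  about the weight.\<close>

fun gram_schmidt :: "(nat \<Rightarrow> real) \<Rightarrow> nat \<Rightarrow> real poly" where
  "gram_schmidt w n = monom 1 n - (\<Sum>k<n.
     smult (weight_integral w (monom 1 n * gram_schmidt w k) /
            weight_integral w (gram_schmidt w k * gram_schmidt w k)) (gram_schmidt w k))"

text \<open>The equation matches every \<open>n\<close> and recurs under the sum, so as a simp rule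
  it would loop.\<close>

declare gram_schmidt.simps [simp del]

lemma degree_gram_schmidt_le: "degree (gram_schmidt w n) \<le> n"
proof (induction n rule: less_induct)
  case (less n)
  have "degree (\<Sum>k<n. smult (weight_integral w (monom 1 n * gram_schmidt w k) /
            weight_integral w (gram_schmidt w k * gram_schmidt w k)) (gram_schmidt w k)) \<le> n"
    by (intro degree_sum_le) (use less in \<open>auto intro!: order.trans[OF degree_smult_le] dest: less_imp_le intro: order.trans\<close>)
  then show ?case
    by (subst gram_schmidt.simps) (auto intro!: degree_diff_le simp: degree_monom_le)
qed

lemma coeff_gram_schmidt_top: "coeff (gram_schmidt w n) n = 1"
proof -
  have "coeff (gram_schmidt w k) n = 0" if "k < n" for k
    using degree_gram_schmidt_le[of w k] that by (intro coeff_eq_0) linarith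
  then show ?thesis
    by (subst gram_schmidt.simps) (simp add: coeff_sum)
qed

lemma degree_gram_schmidt [simp]: "degree (gram_schmidt w n) = n"
  by (intro antisym degree_gram_schmidt_le le_degree) (simp add: coeff_gram_schmidt_top)

lemma gram_schmidt_nonzero: "gram_schmidt w n \<noteq> 0"
  using coeff_gram_schmidt_top[of w n] by auto

lemma poly_altdef_le:
  fixes x :: "'a::{comm_semiring_0,semiring_1}"
  assumes "degree p \<le> N"
  shows "poly p x = (\<Sum>i\<le>N. coeff p i * x ^ i)"
  unfolding poly_altdef using assms
  by (intro sum.mono_neutral_left) (auto simp: coeff_eq_0)

text \<open>Positivity at every nonnegative integer gives infinite support, hence a definite inner
  product; finite moments make every polynomial integrable.\<close>

locale positive_weight =
  fixes w :: "nat \<Rightarrow> real"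
  assumes positive: "w x > 0"
    and moments: "summable (\<lambda>x. real x ^ k * w x)"
begin

text \<open>A bound \<open>N\<close> in place of the degree lets a whole family of polynomials share
  one index range when limits are taken.\<close>

lemma sums_weight_integral:
  assumes "degree p \<le> N"
  shows "(\<lambda>x. poly p (real x) * w x) sums
           (\<Sum>i\<le>N. coeff p i * (\<Sum>x. real x ^ i * w x))"
proof -
  have "(\<lambda>x. \<Sum>i\<le>N. coeff p i * (real x ^ i * w x)) sums
          (\<Sum>i\<le>N. coeff p i * (\<Sum>x. real x ^ i * w x))"
    by (intro sums_sum sums_mult summable_sums moments)
  moreover have "poly p (real x) * w x = (\<Sum>i\<le>N. coeff p i * (real x ^ i * w x))" for x
    using assms by (simp add: poly_altdef_le[of _ N] sum_distrib_right mult.assoc)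
  ultimately show ?thesis by simp
qed

lemma weight_integral_eq_moments:
  "degree p \<le> N \<Longrightarrow>
     weight_integral w p = (\<Sum>i\<le>N. coeff p i * (\<Sum>x. real x ^ i * w x))"
  unfolding weight_integral_def by (intro sums_unique[symmetric] sums_weight_integral)

lemma summable_weight: "summable (\<lambda>x. poly p (real x) * w x)"
  using sums_weight_integral[OF order.refl] by (rule sums_summable)

section \<open>Linearity and definiteness of the integral\<close>

lemma weight_integral_add:
  "weight_integral w (p + q) = weight_integral w p + weight_integral w q"
  unfolding weight_integral_def using summable_weight
  by (subst suminf_add) (auto simp: algebra_simps)

lemma weight_integral_smult: "weight_integral w (smult a p) = a * weight_integral w p"
  unfolding weight_integral_def using summable_weight
  by (subst suminf_mult[symmetric]) (auto simp: algebra_simps)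

lemma weight_integral_0: "weight_integral w 0 = 0"
  by (simp add: weight_integral_def)

lemma weight_integral_diff:
  "weight_integral w (p - q) = weight_integral w p - weight_integral w q"
  using weight_integral_add[of "p - q" q] by simp

lemma weight_integral_sum:
  "weight_integral w (sum f A) = (\<Sum>i\<in>A. weight_integral w (f i))"
  by (induction A rule: infinite_finite_induct)
     (simp_all add: weight_integral_0 weight_integral_add)

text \<open>A series of nonnegative terms with sum zero has only zero terms, so \<open>p\<close>
  vanishes at every nonnegative integer and has infinitely many roots.\<close>

lemma weight_integral_square_eq_0_iff: "weight_integral w (p * p) = 0 \<longleftrightarrow> p = 0"
proof
  assume "weight_integral w (p * p) = 0"
  moreover have "poly (p * p) (real x) * w x \<ge> 0" for x
    using positive[of x] by (simp add: less_imp_le)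
  ultimately have "\<forall>x. poly (p * p) (real x) * w x = 0"
    unfolding weight_integral_def using summable_weight suminf_eq_zero_iff by blast
  then have "range real \<subseteq> {x. poly p x = 0}"
    using positive by (force simp: less_imp_neq[symmetric])
  moreover have "infinite (range real)"
    by (simp add: finite_image_iff inj_on_def)
  ultimately show "p = 0"
    using poly_roots_finite finite_subset by blast
qed (simp add: weight_integral_0)

text \<open>After expansion of \<open>gram_schmidt w n\<close>, strong induction kills every term of
  the sum except \<open>k = j\<close>, which cancels the integral of
  \<open>monom 1 n * gram_schmidt w j\<close>.\<close>

lemma gram_schmidt_orthogonal:
  "j < n \<Longrightarrow> weight_integral w (gram_schmidt w n * gram_schmidt w j) = 0"
proof (induction n arbitrary: j rule: less_induct)
  case (less n)
  let ?g = "gram_schmidt w" and ?I = "weight_integral w"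
  \<comment> \<open>The induction hypothesis is applied at the larger of \<open>k\<close> and
    \<open>j\<close>; commutativity covers the other order.\<close>
  have orth: "?I (?g k * ?g j) = 0" if "k < n" "k \<noteq> j" for k
    using that less.IH[of k j] less.IH[of j k] less.prems by (cases "k < j") (auto simp: mult.commute)
  have "?I (?g n * ?g j) = ?I (monom 1 n * ?g j) -
          (\<Sum>k<n. ?I (monom 1 n * ?g k) / ?I (?g k * ?g k) * ?I (?g k * ?g j))"
    by (subst gram_schmidt.simps)
       (simp add: algebra_simps sum_distrib_left weight_integral_diff weight_integral_sum
         weight_integral_smult)
  also have "(\<Sum>k<n. ?I (monom 1 n * ?g k) / ?I (?g k * ?g k) * ?I (?g k * ?g j)) =
      (\<Sum>k<n. if k = j then ?I (monom 1 n * ?g j) else 0)"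
    using orth
    by (intro sum.cong) (auto simp: weight_integral_square_eq_0_iff gram_schmidt_nonzero)
  finally show ?case using less.prems by simp
qed

text \<open>Subtracting the multiple of \<open>gram_schmidt w (degree q)\<close> that cancels the
  leading term of \<open>q\<close> lowers the degree, so induction applies.\<close>

lemma gram_schmidt_orthogonal_lower_degree:
  "degree q < n \<Longrightarrow> weight_integral w (gram_schmidt w n * q) = 0"
proof (induction "degree q" arbitrary: q rule: less_induct)
  case less
  define r where "r = q - smult (lead_coeff q) (gram_schmidt w (degree q))"
  have "degree r \<le> degree q"
    unfolding r_def by (intro degree_diff_le) (auto intro: order.trans[OF degree_smult_le])
  moreover have "coeff r (degree q) = 0"
    by (simp add: r_def coeff_gram_schmidt_top)
  \<comment> \<open>For constant \<open>q\<close> the remainder is zero and its degree does not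
    drop, hence the separate case.\<close>
  ultimately have "r = 0 \<or> degree r < degree q"
    by (rule eq_zero_or_degree_less)
  then have "weight_integral w (gram_schmidt w n * r) = 0"
    using less by (auto simp: weight_integral_0)
  moreover have "gram_schmidt w n * q = gram_schmidt w n * r +
      smult (lead_coeff q) (gram_schmidt w n * gram_schmidt w (degree q))"
    by (simp add: r_def algebra_simps)
  ultimately show ?case
    using less.prems by (simp add: weight_integral_add weight_integral_smult gram_schmidt_orthogonal)
qed

section \<open>Existence and uniqueness of monic orthogonal polynomials\<close>

lemma sums_0_iff_weight_integral:
  "(\<lambda>x. poly p (real x) * real x ^ k * w x) sums 0 \<longleftrightarrow> weight_integral w (p * monom 1 k) = 0"
  using summable_weight[of "p * monom 1 k"]
  by (simp add: weight_integral_def sums_iff poly_monom)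

lemma is_monic_OP_gram_schmidt: "is_monic_OP w n (gram_schmidt w n)"
  using gram_schmidt_orthogonal_lower_degree
  by (auto simp: is_monic_OP_def coeff_gram_schmidt_top sums_0_iff_weight_integral degree_monom_eq)

text \<open>Leading terms cancel in the difference, so it is orthogonal to every power up to its own
  degree, hence to itself, and definiteness makes it zero.\<close>

lemma is_monic_OP_unique:
  assumes "is_monic_OP w n p" "is_monic_OP w n q"
  shows "p = q"
proof -
  have "degree (p - q) \<le> n" "coeff (p - q) n = 0"
    using assms by (auto simp: is_monic_OP_def intro: degree_diff_le)
  then have "p - q = 0 \<or> degree (p - q) < n"
    by (rule eq_zero_or_degree_less)
  moreover have "p - q = 0" if "degree (p - q) < n"
  proof -
    have orth: "weight_integral w ((p - q) * monom 1 k) = 0" if "k < n" for k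
      using assms that
      by (simp add: is_monic_OP_def sums_0_iff_weight_integral left_diff_distrib
          weight_integral_diff)
    have "(p - q) * (p - q) =
        (\<Sum>k\<le>degree (p - q). smult (coeff (p - q) k) ((p - q) * monom 1 k))"
      by (subst (2) poly_as_sum_of_monoms[symmetric])
         (simp add: sum_distrib_left smult_monom flip: mult_smult_right)
    then have "weight_integral w ((p - q) * (p - q)) =
        (\<Sum>k\<le>degree (p - q). coeff (p - q) k * weight_integral w ((p - q) * monom 1 k))"
      by (simp only: weight_integral_sum weight_integral_smult)
    also have "\<dots> = 0"
      using that orth by (intro sum.neutral) auto
    finally show ?thesis
      by (simp only: weight_integral_square_eq_0_iff)
  qed
  ultimately show ?thesis by auto
qed

lemma monic_OP_eq_gram_schmidt: "monic_OP w n = gram_schmidt w n"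
  unfolding monic_OP_def using is_monic_OP_gram_schmidt is_monic_OP_unique by blast

end

section \<open>Continuity in the moments\<close>

lemma tendsto_coeff_mult:
  fixes p q :: "'b \<Rightarrow> 'a::real_normed_field poly"
  assumes "\<And>i. ((\<lambda>b. coeff (p b) i) \<longlongrightarrow> coeff p' i) F"
    and "\<And>i. ((\<lambda>b. coeff (q b) i) \<longlongrightarrow> coeff q' i) F"
  shows "((\<lambda>b. coeff (p b * q b) i) \<longlongrightarrow> coeff (p' * q') i) F"
  unfolding coeff_mult by (intro tendsto_intros assms)

text \<open>Admissibility of \<open>W b\<close> is asked only eventually, because the generalized
  Charlier weights are treated for \<open>\<beta> > 0\<close>, which holds eventually at
  infinity.\<close>

locale convergent_weights = positive_weight w for w :: "nat \<Rightarrow> real" +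
  fixes W :: "'b \<Rightarrow> nat \<Rightarrow> real" and F :: "'b filter"
  assumes eventually_positive_weight: "eventually (\<lambda>b. positive_weight (W b)) F"
    and tendsto_moments:
      "((\<lambda>b. \<Sum>x. real x ^ k * W b x) \<longlongrightarrow> (\<Sum>x. real x ^ k * w x)) F"
begin

text \<open>With degrees bounded uniformly by \<open>N\<close>, the integral is a fixed finite sum
  of products of a coefficient and a moment, and both factors converge.\<close>

lemma tendsto_weight_integral:
  assumes "\<And>i. ((\<lambda>b. coeff (p b) i) \<longlongrightarrow> coeff p' i) F"
    and "\<And>b. degree (p b) \<le> N" and "degree p' \<le> N"
  shows "((\<lambda>b. weight_integral (W b) (p b)) \<longlongrightarrow> weight_integral w p') F"
proof -
  have "((\<lambda>b. \<Sum>i\<le>N. coeff (p b) i * (\<Sum>x. real x ^ i * W b x)) \<longlongrightarrow>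
          weight_integral w p') F"
    unfolding weight_integral_eq_moments[OF assms(3)]
    by (intro tendsto_intros assms tendsto_moments)
  \<comment> \<open>The moment formula is available only where \<open>W b\<close> is admissible, so
    the limit is transferred along eventual equality.\<close>
  moreover have "eventually (\<lambda>b. (\<Sum>i\<le>N. coeff (p b) i * (\<Sum>x. real x ^ i * W b x)) =
      weight_integral (W b) (p b)) F"
    using eventually_positive_weight
    by eventually_elim (simp add: positive_weight.weight_integral_eq_moments[OF _ assms(2)])
  ultimately show ?thesis
    using tendsto_cong by fast
qed

text \<open>By strong induction, each Gram-Schmidt coefficient is a quotient of convergent
  integrals, whose denominator has a nonzero limit by definiteness for \<open>w\<close>.\<close>

lemma tendsto_coeff_gram_schmidt:
  "((\<lambda>b. coeff (gram_schmidt (W b) n) i) \<longlongrightarrow> coeff (gram_schmidt w n) i) F"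
proof (induction n arbitrary: i rule: less_induct)
  case (less n)
  \<comment> \<open>This bound and the next hold for any \<open>v\<close>, hence uniformly in
    \<open>b\<close>, as \<open>tendsto_weight_integral\<close> demands.\<close>
  have deg1: "degree (monom 1 n * gram_schmidt v k) \<le> n + k" for v k
    by (rule order.trans[OF degree_mult_le]) (simp add: degree_monom_eq)
  have deg2: "degree (gram_schmidt v k * gram_schmidt v k) \<le> k + k" for v k
    by (rule order.trans[OF degree_mult_le]) simp
  have "((\<lambda>b. weight_integral (W b) (monom 1 n * gram_schmidt (W b) k)) \<longlongrightarrow>
      weight_integral w (monom 1 n * gram_schmidt w k)) F" if "k < n" for k
    using that by (intro tendsto_weight_integral[OF _ deg1 deg1] tendsto_coeff_mult less.IH tendsto_const)
  moreover have "((\<lambda>b. weight_integral (W b) (gram_schmidt (W b) k * gram_schmidt (W b) k)) \<longlongrightarrow>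
      weight_integral w (gram_schmidt w k * gram_schmidt w k)) F" if "k < n" for k
    using that by (intro tendsto_weight_integral[OF _ deg2 deg2] tendsto_coeff_mult less.IH)
  moreover have "weight_integral w (gram_schmidt w k * gram_schmidt w k) \<noteq> 0" for k
    by (simp add: weight_integral_square_eq_0_iff gram_schmidt_nonzero)
  ultimately have "((\<lambda>b. coeff (monom 1 n) i - (\<Sum>k<n.
      weight_integral (W b) (monom 1 n * gram_schmidt (W b) k) /
      weight_integral (W b) (gram_schmidt (W b) k * gram_schmidt (W b) k) *
      coeff (gram_schmidt (W b) k) i)) \<longlongrightarrow>
    coeff (monom 1 n) i - (\<Sum>k<n.
      weight_integral w (monom 1 n * gram_schmidt w k) /
      weight_integral w (gram_schmidt w k * gram_schmidt w k) *
      coeff (gram_schmidt w k) i)) F"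
    by (intro tendsto_intros less.IH) auto
  then show ?case
    by (subst (1 2) gram_schmidt.simps) (simp add: coeff_sum)
qed

text \<open>Since the degree is \<open>n\<close> throughout, evaluation is a finite sum over
  \<open>i \<le> n\<close>, and convergence of the coefficients suffices.\<close>

lemma tendsto_poly_monic_OP:
  "((\<lambda>b. poly (map_poly complex_of_real (monic_OP (W b) n)) x) \<longlongrightarrow>
     poly (map_poly complex_of_real (monic_OP w n)) x) F"
proof -
  have eq: "poly (map_poly complex_of_real (gram_schmidt v n)) x =
      (\<Sum>i\<le>n. complex_of_real (coeff (gram_schmidt v n) i) * x ^ i)" for v
    by (simp add: poly_altdef_le[of _ n] coeff_map_poly degree_map_poly)
  have "((\<lambda>b. poly (map_poly complex_of_real (gram_schmidt (W b) n)) x) \<longlongrightarrow>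
     poly (map_poly complex_of_real (gram_schmidt w n)) x) F"
    unfolding eq by (intro tendsto_intros tendsto_coeff_gram_schmidt)
  moreover have "eventually (\<lambda>b. poly (map_poly complex_of_real (gram_schmidt (W b) n)) x =
      poly (map_poly complex_of_real (monic_OP (W b) n)) x) F"
    using eventually_positive_weight
    by eventually_elim (simp add: positive_weight.monic_OP_eq_gram_schmidt)
  ultimately show ?thesis
    unfolding monic_OP_eq_gram_schmidt using tendsto_cong by fast
qed

end

section \<open>The Charlier weights\<close>

text \<open>From \<open>real x \<le> 2 ^ x\<close>, the factor \<open>real x ^ k\<close> is at most
  \<open>(2 ^ k) ^ x\<close>, so the exponential series at \<open>2 ^ k * c\<close> is a
  majorant.\<close>

lemma summable_charlier_moments:
  assumes "c \<ge> 0"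
  shows "summable (\<lambda>x. real x ^ k * charlier_weight c x)"
proof (rule summable_comparison_test')
  show "summable (\<lambda>x. (2 ^ k * c) ^ x / fact x)"
    using summable_exp[of "2 ^ k * c"] by (simp add: field_simps)
  fix x :: nat
  have "real x ^ k \<le> (2 ^ x) ^ k"
    by (intro power_mono less_imp_le[OF of_nat_less_two_power]) auto
  then have "real x ^ k * c ^ x \<le> (2 ^ k) ^ x * c ^ x"
    using assms by (intro mult_right_mono) (auto simp flip: power_mult simp: mult.commute)
  then show "norm (real x ^ k * charlier_weight c x) \<le> (2 ^ k * c) ^ x / fact x"
    using assms by (simp add: charlier_weight_def power_mult_distrib divide_right_mono)
qed

text \<open>Each of the \<open>x\<close> factors from \<open>b + 1\<close> to \<open>b + x\<close>
  is at least \<open>b\<close>. This yields a majorant independent of \<open>\<beta>\<close> for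
  Tannery's theorem.\<close>

lemma power_le_pochhammer_Suc:
  fixes b :: real
  assumes "b \<ge> 0"
  shows "b ^ x \<le> pochhammer (b + 1) x"
proof (induction x)
  case (Suc x)
  then have "b ^ x * b \<le> pochhammer (b + 1) x * (b + 1 + real x)"
    using assms by (intro mult_mono pochhammer_nonneg) auto
  then show ?case
    by (simp add: pochhammer_Suc mult.commute)
qed simp

lemma gen_charlier_weight_pos: "\<beta> > 0 \<Longrightarrow> z > 0 \<Longrightarrow> gen_charlier_weight \<beta> z x > 0"
  by (simp add: gen_charlier_weight_def pochhammer_pos)

lemma gen_charlier_weight_le:
  assumes "\<beta> > 0" "c > 0"
  shows "gen_charlier_weight \<beta> (c * \<beta>) x \<le> charlier_weight c x"
proof -
  have "c ^ x * \<beta> ^ x \<le> c ^ x * pochhammer (\<beta> + 1) x"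
    using assms by (intro mult_left_mono power_le_pochhammer_Suc) auto
  then show ?thesis
    using assms by (simp add: gen_charlier_weight_def charlier_weight_def power_mult_distrib
        divide_simps pochhammer_pos)
qed

text \<open>For fixed \<open>x\<close> the quotient of \<open>\<beta> ^ x\<close> by the Pochhammer
  symbol is a product of \<open>x\<close> factors \<open>\<beta> / (\<beta> + 1 + i)\<close>, each
  tending to 1.\<close>

lemma tendsto_gen_charlier_weight:
  "((\<lambda>\<beta>. gen_charlier_weight \<beta> (c * \<beta>) x) \<longlongrightarrow> charlier_weight c x) at_top"
proof -
  have "((\<lambda>\<beta>::real. \<beta> ^ x / pochhammer (\<beta> + 1) x) \<longlongrightarrow> 1) at_top"
  proof (induction x)
    case (Suc x)
    have "((\<lambda>\<beta>::real. \<beta> / (\<beta> + 1 + real x)) \<longlongrightarrow> 1) at_top"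
      by real_asymp
    from tendsto_mult[OF Suc this] show ?case
      by (simp add: pochhammer_Suc mult.commute)
  qed simp
  from tendsto_mult[OF this tendsto_const[of "c ^ x / fact x"]] show ?thesis
    by (simp add: gen_charlier_weight_def charlier_weight_def power_mult_distrib field_simps)
qed

section \<open>Moments of the two weights\<close>

lemma positive_weight_charlier: "c > 0 \<Longrightarrow> positive_weight (charlier_weight c)"
  by unfold_locales (simp_all add: summable_charlier_moments, simp add: charlier_weight_def)

lemma gen_charlier_moment_term_le:
  assumes "\<beta> > 0" "c > 0"
  shows "norm (real x ^ k * gen_charlier_weight \<beta> (c * \<beta>) x) \<le> real x ^ k * charlier_weight c x"
  using gen_charlier_weight_le[OF assms] gen_charlier_weight_pos[of \<beta> "c * \<beta>" x] assms
  by (simp add: abs_mult mult_left_mono)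

lemma positive_weight_gen_charlier:
  assumes "\<beta> > 0" "c > 0"
  shows "positive_weight (gen_charlier_weight \<beta> (c * \<beta>))"
proof
  show "gen_charlier_weight \<beta> (c * \<beta>) x > 0" for x
    using assms by (simp add: gen_charlier_weight_pos)
  show "summable (\<lambda>x. real x ^ k * gen_charlier_weight \<beta> (c * \<beta>) x)" for k
    using assms
    by (intro summable_comparison_test'[OF summable_charlier_moments gen_charlier_moment_term_le]) auto
qed

lemma tendsto_gen_charlier_moments:
  assumes "c > 0"
  shows "((\<lambda>\<beta>. \<Sum>x. real x ^ k * gen_charlier_weight \<beta> (c * \<beta>) x) \<longlongrightarrow>
           (\<Sum>x. real x ^ k * charlier_weight c x)) at_top"
proof -
  \<comment> \<open>Tannery's theorem takes the domination along a product filter; here it holds for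
    every \<open>x\<close> once \<open>\<beta> > 0\<close>.\<close>
  have "eventually (\<lambda>(x, \<beta>). norm (real x ^ k * gen_charlier_weight \<beta> (c * \<beta>) x) \<le>
      real x ^ k * charlier_weight c x) (at_top \<times>\<^sub>F at_top)"
    unfolding eventually_prod_filter
    using gen_charlier_moment_term_le[OF _ assms] eventually_gt_at_top[of "0::real"]
    by (intro exI[of _ "\<lambda>_. True"] exI[of _ "\<lambda>\<beta>. \<beta> > 0"]) auto
  from tannerys_theorem[OF tendsto_mult[OF tendsto_const tendsto_gen_charlier_weight] this
      summable_charlier_moments[OF less_imp_le[OF assms]] trivial_limit_at_top_linorder]
  show ?thesis by blast
qed

theorem mainTheorem6:
  fixes c :: real and n :: nat and x :: complex
  assumes "c > 0"
  shows "((\<lambda>\<beta>::real. poly (map_poly complex_of_real (monic_gen_charlier \<beta> (c * \<beta>) n)) x)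
           \<longlongrightarrow> poly (map_poly complex_of_real (monic_charlier c n)) x) at_top"
proof -
  interpret positive_weight "charlier_weight c"
    using assms by (rule positive_weight_charlier)
  interpret convergent_weights "charlier_weight c"
    "\<lambda>\<beta>. gen_charlier_weight \<beta> (c * \<beta>)" at_top
  proof
    show "\<forall>\<^sub>F \<beta> in at_top. positive_weight (gen_charlier_weight \<beta> (c * \<beta>))"
      using eventually_gt_at_top[of 0] by eventually_elim (simp add: positive_weight_gen_charlier assms)
  qed (rule tendsto_gen_charlier_moments[OF assms])
  show ?thesis
    unfolding monic_gen_charlier_def monic_charlier_def by (rule tendsto_poly_monic_OP)
qed

end
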